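(* Let $G$ be a cubic graph with base embedding $\widehat{\Pi}$, and let $\Pi$ be an embedding of $G$ whose unstable dual $G^*_\Pi$ is the cycle graph $C_k$ (where $C_1$ is a loop and $C_2$ is a pair of parallel edges). If $G^*_\Pi$ is zero-homologous on the surface of the base embedding $\widehat{\Pi}$, then $$\Delta g(\Pi)=\left\lfloor\frac{k-1}{2}\right\rfloor.$$
   Context: $G$ is a finite connected graph. All embeddings are 2-cell embeddings in closed orientable surfaces and are described by rotation systems: an embedding $\Pi$ assigns to each vertex $v$ a clockwise cyclic ordering $\pi_v$ of the edges incident with $v$. $g(\Pi)$ is the genus of the surface of $\Pi$. Fix a base embedding $\widehat{\Pi}$ with local rotations $\widehat{\pi}_v$. A vertex $v$ is $\Pi$-unstable if $\pi_v\neq\widehat{\pi}_v$; an edge is $\Pi$-unstable if exactly one of its endpoints is $\Pi$-unstable; a face of $\widehat{\Pi}$ is $\Pi$-unstable if its boundary contains at least one $\Pi$-unstable edge. Let $G^*$ be the dual graph of $G$ with respect to $\widehat{\Pi}$, embedded in the same surface as $\widehat{\Pi}$ (it may have loops and parallel edges). The $\Pi$-unstable dual $G^*_\Pi$ is the subgraph of $G^*$ whose vertices are the $\Pi$-unstable faces and whose edges are the dual edges of the $\Pi$-unstable edges. A subgraph $H^*$ of $G^*$ is zero-homologous if its edges separate the surface into two parts $A\cup B$ with $\partial A=\partial B=E(H^* )$; equivalently, $E(H^* )$ is the mod-2 sum of the boundaries of some set of faces of $G^*$. $\Delta g(\Pi)=g(\Pi)-g(\widehat{\Pi})$. *)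

theory Defs
  imports "Graph_Theory.Graph_Theory" "HOL-Combinatorics.Orbits"
begin

text \<open>
  Finite undirected multigraphs (loops and parallel edges allowed) are bidirected digraphs:
  an undirected edge is a pair \<open>{d, r d}\<close> of mutually reverse arcs (its two half-edges), where
  \<open>d\<close> is the half-edge attached to \<open>tail G d\<close>.  A loop contributes two arcs to \<open>out_arcs G v\<close>,
  so \<open>out_degree\<close> is the degree of the undirected graph.
\<close>

text \<open>
  An embedding: \<open>s d\<close> is the clockwise successor of \<open>d\<close> around \<open>tail G d\<close>, so the restriction of
  \<open>s\<close> to \<open>out_arcs G v\<close> is the local rotation at \<open>v\<close>.
\<close>

locale rotation_system = fin_digraph G + bidirected_digraph G r
  for G :: "('a, 'b) pre_digraph" and r :: "'b \<Rightarrow> 'b" +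
  fixes s :: "'b \<Rightarrow> 'b"
  assumes rotation_permutes: "s permutes arcs G"
    and rotation_cyclic: "\<And>v. v \<in> verts G \<Longrightarrow> out_arcs G v \<noteq> {} \<Longrightarrow> cyclic_on s (out_arcs G v)"

text \<open>
  Face tracing: after traversing \<open>d\<close> one leaves its head along the successor of \<open>r d\<close>.
  A face is the set of arcs traversed; the two sides of an edge are its two arcs, so the edge
  \<open>{d, r d}\<close> is on the boundary of a face iff the face contains \<open>d\<close> or \<open>r d\<close>.
\<close>

definition face_of :: "('b \<Rightarrow> 'b) \<Rightarrow> ('b \<Rightarrow> 'b) \<Rightarrow> 'b \<Rightarrow> 'b set" where
  "face_of r s d = orbit (s \<circ> r) d"

definition faces :: "('a, 'b) pre_digraph \<Rightarrow> ('b \<Rightarrow> 'b) \<Rightarrow> ('b \<Rightarrow> 'b) \<Rightarrow> 'b set set" where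
  "faces G r s = face_of r s ` arcs G"

definition edges :: "('a, 'b) pre_digraph \<Rightarrow> ('b \<Rightarrow> 'b) \<Rightarrow> 'b set set" where
  "edges G r = (\<lambda>d. {d, r d}) ` arcs G"

definition euler_char :: "('a, 'b) pre_digraph \<Rightarrow> ('b \<Rightarrow> 'b) \<Rightarrow> ('b \<Rightarrow> 'b) \<Rightarrow> int" where
  "euler_char G r s = int (card (verts G)) - int (card (edges G r)) + int (card (faces G r s))"

text \<open>
  The genus \<open>g\<close> of the surface, from \<open>V - E + F = 2 - 2 g\<close>.  For a connected graph with at
  least one edge the Euler characteristic of a rotation system is even, so the division is exact.
\<close>

definition genus :: "('a, 'b) pre_digraph \<Rightarrow> ('b \<Rightarrow> 'b) \<Rightarrow> ('b \<Rightarrow> 'b) \<Rightarrow> int" where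
  "genus G r s = (2 - euler_char G r s) div 2"

text \<open>
  The dual has the same arcs and the same reversal \<open>r\<close>: the arc dual to \<open>d\<close> leads from the face
  on the side \<open>d\<close> to the face on the side \<open>r d\<close>.  The out-arcs of a face \<open>f\<close> are the elements
  of \<open>f\<close>, and \<open>dual_rotation\<close> orders them along the boundary walk of \<open>f\<close>.  (This walk runs
  anticlockwise, so the dual is described on the surface with reversed orientation; the faces of
  the dual and their boundaries do not depend on that.)
\<close>

definition dual :: "('a, 'b) pre_digraph \<Rightarrow> ('b \<Rightarrow> 'b) \<Rightarrow> ('b \<Rightarrow> 'b) \<Rightarrow> ('b set, 'b) pre_digraph" where
  "dual G r s = \<lparr> verts = faces G r s, arcs = arcs G,
     tail = face_of r s, head = (\<lambda>d. face_of r s (r d)) \<rparr>"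

definition dual_rotation :: "('b \<Rightarrow> 'b) \<Rightarrow> ('b \<Rightarrow> 'b) \<Rightarrow> 'b \<Rightarrow> 'b" where
  "dual_rotation r s = s \<circ> r"

text \<open>Below, \<open>s0\<close> is the base embedding and \<open>s\<close> the other embedding.\<close>

definition unstable_verts :: "('a, 'b) pre_digraph \<Rightarrow> ('b \<Rightarrow> 'b) \<Rightarrow> ('b \<Rightarrow> 'b) \<Rightarrow> 'a set" where
  "unstable_verts G s0 s = {v \<in> verts G. \<exists>d \<in> out_arcs G v. s d \<noteq> s0 d}"

definition unstable_arcs :: "('a, 'b) pre_digraph \<Rightarrow> ('b \<Rightarrow> 'b) \<Rightarrow> ('b \<Rightarrow> 'b) \<Rightarrow> 'b set" where
  "unstable_arcs G s0 s = {d \<in> arcs G.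
     (tail G d \<in> unstable_verts G s0 s) \<noteq> (head G d \<in> unstable_verts G s0 s)}"

definition unstable_faces ::
  "('a, 'b) pre_digraph \<Rightarrow> ('b \<Rightarrow> 'b) \<Rightarrow> ('b \<Rightarrow> 'b) \<Rightarrow> ('b \<Rightarrow> 'b) \<Rightarrow> 'b set set" where
  "unstable_faces G r s0 s = {f \<in> faces G r s0. f \<inter> unstable_arcs G s0 s \<noteq> {}}"

definition unstable_dual ::
  "('a, 'b) pre_digraph \<Rightarrow> ('b \<Rightarrow> 'b) \<Rightarrow> ('b \<Rightarrow> 'b) \<Rightarrow> ('b \<Rightarrow> 'b) \<Rightarrow> ('b set, 'b) pre_digraph" where
  "unstable_dual G r s0 s = \<lparr> verts = unstable_faces G r s0 s, arcs = unstable_arcs G s0 s,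
     tail = tail (dual G r s0), head = head (dual G r s0) \<rparr>"

text \<open>Isomorphism of undirected multigraphs: a digraph isomorphism respecting arc reversal.\<close>

definition multigraph_iso ::
  "('a, 'b) pre_digraph \<Rightarrow> ('b \<Rightarrow> 'b) \<Rightarrow> ('c, 'd) pre_digraph \<Rightarrow> ('d \<Rightarrow> 'd) \<Rightarrow> bool" where
  "multigraph_iso G r H r' \<longleftrightarrow>
     (\<exists>f. pre_digraph.digraph_isomorphism G f \<and> H = app_iso f G \<and>
          (\<forall>d \<in> arcs G. iso_arcs f (r d) = r' (iso_arcs f d)))"

text \<open>
  The cycle \<open>C\<^sub>k\<close> for \<open>k \<ge> 1\<close>: the \<open>i\<close>-th edge joins \<open>i\<close> and \<open>i + 1\<close> modulo \<open>k\<close>, so \<open>C\<^sub>1\<close> is a loop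
  and \<open>C\<^sub>2\<close> a pair of parallel edges.
\<close>

definition cycle_graph :: "nat \<Rightarrow> (nat, nat \<times> bool) pre_digraph" where
  "cycle_graph k = \<lparr> verts = {..<k}, arcs = {..<k} \<times> UNIV,
     tail = (\<lambda>(i, fwd). if fwd then i else Suc i mod k),
     head = (\<lambda>(i, fwd). if fwd then Suc i mod k else i) \<rparr>"

definition cycle_graph_rev :: "nat \<times> bool \<Rightarrow> nat \<times> bool" where
  "cycle_graph_rev = (\<lambda>(i, fwd). (i, \<not> fwd))"

text \<open>
  Mod-2 boundary of a face, as a set of arcs closed under reversal: an edge both of whose sides
  lie on the face is counted twice and cancels.
\<close>

definition face_boundary :: "('a, 'b) pre_digraph \<Rightarrow> ('b \<Rightarrow> 'b) \<Rightarrow> 'b set \<Rightarrow> 'b set" where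
  "face_boundary G r f = {d \<in> arcs G. (d \<in> f) \<noteq> (r d \<in> f)}"

text \<open>
  For a graph \<open>G\<close> embedded by \<open>s\<close>: the subgraph \<open>H\<close> is zero-homologous if its edge set is the mod-2
  sum of the boundaries of some set of faces.
\<close>

definition zero_homologous ::
  "('a, 'b) pre_digraph \<Rightarrow> ('b \<Rightarrow> 'b) \<Rightarrow> ('b \<Rightarrow> 'b) \<Rightarrow> ('a, 'b) pre_digraph \<Rightarrow> bool" where
  "zero_homologous G r s H \<longleftrightarrow>
     (\<exists>F \<subseteq> faces G r s. arcs H = {d \<in> arcs G. odd (card {f \<in> F. d \<in> face_boundary G r f})})"

end

theory Submission
  imports Defs
begin

text \<open>
  In a cubic graph the only other rotation at a vertex is the reverse one, so \<open>\<Pi>\<close> arises by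
  reversing the rotations at the unstable vertices.  The unstable edges cut the surface along the
  dual cycle.  Faces of \<open>\<Pi>\<close> that cross no unstable edge are base faces, reversed on the unstable
  side.  Each of the \<open>k\<close> base faces on the cycle splits into a segment on either side, and segment
  \<open>i\<close> joins the unstable edges \<open>i\<close> and \<open>i + 1\<close>.  Reversing one side glues every segment to the next
  one along the cycle, so that a new face visits every second segment: there are
  \<open>gcd 2 k\<close> of them instead of \<open>k\<close>.
\<close>

section \<open>Rotations of order three\<close>

lemma cyclic_on_card_3:
  assumes "cyclic_on f A" "card A = 3" "inj f" "a \<in> A"
  shows "A = {a, f a, f (f a)}" "f (f (f a)) = a" "f a \<noteq> a" "f (f a) \<noteq> a" "f (f a) \<noteq> f a"
proof -
  have orb: "orbit f a = A"
    using assms by (simp add: orbit_cyclic_eq3)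
  show 1: "f a \<noteq> a"
  proof
    assume "f a = a"
    then have "orbit f a = {a}" by (simp add: orbit_eq_singleton_iff)
    with orb assms show False by auto
  qed
  show 2: "f (f a) \<noteq> a"
  proof
    assume "f (f a) = a"
    then have "orbit f a = {(f ^^ m) a | m. m < 2}"
      by (intro orbit_altdef_bounded) (auto simp: numeral_2_eq_2)
    also have "\<dots> \<subseteq> {a, f a}" by (auto simp: less_2_cases_iff)
    finally have "A \<subseteq> {a, f a}" using orb by simp
    then have "card A \<le> card {a, f a}" by (intro card_mono) auto
    with assms 1 show False by auto
  qed
  show 3: "f (f a) \<noteq> f a"
    using 1 assms(3) by (auto dest: injD)
  have mem: "f a \<in> A" "f (f a) \<in> A" "f (f (f a)) \<in> A"
    using assms(1,4) by (auto intro: cyclic_on_inI)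
  show A: "A = {a, f a, f (f a)}"
    using mem assms 1 2 3 by (intro card_subset_eq[symmetric]) (auto intro: finite_cyclic_on)
  show "f (f (f a)) = a"
    using mem(3) 1 2 3 assms(3) unfolding A by (auto dest: injD)
qed

text \<open>A three-element set has exactly two cyclic permutations, inverse to each other, so
  differing at the single point \<open>a\<close> forces \<open>g\<close> to invert \<open>f\<close>
  on all of \<open>A\<close>.\<close>

lemma cyclic_on_card_3_inverse:
  assumes f: "cyclic_on f A" "inj f" and g: "cyclic_on g A" "inj g"
    and A: "card A = 3" and a: "a \<in> A" "g a \<noteq> f a" and x: "x \<in> A"
  shows "g (f x) = x"
proof -
  note F = cyclic_on_card_3[OF f(1) A f(2) a(1)]
  have ga: "g a = f (f a)"
    using cyclic_on_inI[OF g(1) a(1)] cyclic_on_card_3(3)[OF g(1) A g(2) a(1)] a(2) F(1) by auto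
  have fa: "f a \<in> A" "f (f a) \<in> A"
    using F(1) by auto
  have gffa: "g (f (f a)) = f a"
    using cyclic_on_inI[OF g(1) fa(2)] cyclic_on_card_3(3,4)[OF g(1) A g(2) fa(2)]
      cyclic_on_card_3(4)[OF g(1) A g(2) a(1)] ga F(1) by auto
  have gfa: "g (f a) = a"
    using cyclic_on_card_3(2)[OF g(1) A g(2) a(1)] ga gffa by simp
  show ?thesis
    using x F(1,2) ga gffa gfa by auto
qed

section \<open>Faces on the two sides of a cut\<close>

text \<open>\<open>P d\<close> records the side of the tail of \<open>d\<close>, hence
  \<open>P (r d)\<close> that of its head. When \<open>P\<close> says that the tail is unstable, the
  cut consists of the unstable arcs.\<close>

definition cut :: "'b set \<Rightarrow> ('b \<Rightarrow> 'b) \<Rightarrow> ('b \<Rightarrow> bool) \<Rightarrow> 'b set" where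
  "cut D r P = {d \<in> D. P d \<noteq> P (r d)}"

text \<open>Covers the side where \<open>P\<close> fails; the other side is reached by negating
  \<open>P\<close>, which leaves the cut unchanged.\<close>

definition uncut_faces ::
  "'b set \<Rightarrow> ('b \<Rightarrow> 'b) \<Rightarrow> ('b \<Rightarrow> bool) \<Rightarrow> ('b \<Rightarrow> 'b) \<Rightarrow> 'b set set" where
  "uncut_faces D r P s = face_of r s ` {d \<in> D. \<not> P d \<and> face_of r s d \<inter> cut D r P = {}}"

lemma cut_Not: "cut D r (\<lambda>d. \<not> P d) = cut D r P"
  by (auto simp: cut_def)

locale sided_rotation =
  fixes D :: "'b set" and r :: "'b \<Rightarrow> 'b" and P :: "'b \<Rightarrow> bool" and s :: "'b \<Rightarrow> 'b"
  assumes finite_arcs: "finite D"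
    and r_permutes: "r permutes D"
    and r_r [simp]: "\<And>d. r (r d) = d"
    and s_permutes: "s permutes D"
    and P_s [simp]: "\<And>d. P (s d) = P d"
begin

lemma r_in_iff [simp]: "r d \<in> D \<longleftrightarrow> d \<in> D"
  using r_permutes by (rule permutes_in_image)

lemma r_eq_iff [simp]: "r d = r e \<longleftrightarrow> d = e"
  by (metis r_r)

lemma s_in_iff [simp]: "s d \<in> D \<longleftrightarrow> d \<in> D"
  using s_permutes by (rule permutes_in_image)

lemma face_permutation: "permutation (s \<circ> r)"
  using finite_arcs r_permutes s_permutes
  by (intro permutation_compose) (auto simp: permutation_permutes)

lemma self_in_face [simp]: "d \<in> face_of r s d"
  unfolding face_of_def by (rule permutation_self_in_orbit[OF face_permutation])

lemma face_of_eq: "e \<in> face_of r s d \<Longrightarrow> face_of r s e = face_of r s d"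
  unfolding face_of_def
  by (metis cyclic_on_orbit' face_permutation orbit_cyclic_eq3)

lemma face_of_step: "face_of r s (s (r d)) = face_of r s d"
  unfolding face_of_def using permutation_orbit_step[OF face_permutation, of d] by simp

lemma face_subset: "d \<in> D \<Longrightarrow> face_of r s d \<subseteq> D"
  unfolding face_of_def by (intro permutes_orbit_subset permutes_compose r_permutes s_permutes)

lemma r_in_cut [simp]: "r d \<in> cut D r P \<longleftrightarrow> d \<in> cut D r P"
  by (auto simp: cut_def)

text \<open>The step from \<open>e\<close> to \<open>s (r e)\<close> keeps the side of
  \<open>r e\<close>, so a face walk changes sides only at an arc of the cut.\<close>

lemma P_uncut_face:
  assumes "d \<in> D" "face_of r s d \<inter> cut D r P = {}" "e \<in> face_of r s d"
  shows "P e = P d"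
  using assms(3) unfolding face_of_def
proof induction
  case base
  have "d \<notin> cut D r P" using assms(2) self_in_face[of d] by blast
  with assms(1) show ?case by (auto simp: cut_def)
next
  case (step y)
  then have "y \<in> face_of r s d" by (simp add: face_of_def)
  then have "y \<notin> cut D r P" "y \<in> D" using assms(1,2) face_subset by blast+
  with step show ?case by (auto simp: cut_def)
qed

text \<open>A face avoiding the cut lies wholly on one side by \<open>P_uncut_face\<close>; any
  other face is traced from one of its cut arcs.\<close>

lemma card_faces_split:
  "card (face_of r s ` D) = card (uncut_faces D r P s) + card (uncut_faces D r (\<lambda>d. \<not> P d) s)
     + card (face_of r s ` cut D r P)"
proof -
  let ?A = "uncut_faces D r P s" and ?B = "uncut_faces D r (\<lambda>d. \<not> P d) s"
    and ?C = "face_of r s ` cut D r P"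
  have fin: "finite ?A" "finite ?B" "finite ?C"
    using finite_arcs by (auto simp: uncut_faces_def cut_def)
  have "face_of r s ` D = ?A \<union> ?B \<union> ?C"
  proof (intro equalityI subsetI)
    fix f assume "f \<in> face_of r s ` D"
    then obtain d where d: "d \<in> D" "f = face_of r s d" by auto
    show "f \<in> ?A \<union> ?B \<union> ?C"
    proof (cases "f \<inter> cut D r P = {}")
      case True
      then show ?thesis using d by (auto simp: uncut_faces_def cut_Not)
    next
      case False
      then obtain e where "e \<in> f" "e \<in> cut D r P" by auto
      then have "f \<in> ?C" using face_of_eq[of e d] d by auto
      then show ?thesis by simp
    qed
  qed (auto simp: uncut_faces_def cut_def)
  moreover have "?A \<inter> ?B = {}"
  proof -
    have False if "d \<in> D" "e \<in> D" "face_of r s d \<inter> cut D r P = {}" "\<not> P d" "P e"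
      "face_of r s d = face_of r s e" for d e
      using P_uncut_face[OF that(1,3), of e] that(4-6) by simp
    then show ?thesis by (fastforce simp: uncut_faces_def cut_Not)
  qed
  moreover have "(?A \<union> ?B) \<inter> ?C = {}"
  proof -
    have "f \<inter> cut D r P = {}" if "f \<in> ?A \<union> ?B" for f
      using that by (auto simp: uncut_faces_def cut_Not)
    moreover have "f \<inter> cut D r P \<noteq> {}" if "f \<in> ?C" for f
      using that self_in_face by blast
    ultimately show ?thesis by blast
  qed
  ultimately show ?thesis
    using fin by (simp add: card_Un_disjoint)
qed

section \<open>Mirror images: inverting the rotation\<close>

lemma sided_rotation_Not: "sided_rotation D r (\<lambda>d. \<not> P d) s"
  by unfold_locales (simp_all add: finite_arcs r_permutes s_permutes)

lemma s_inv [simp]: "s (inv s d) = d" "inv s (s d) = d"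
  using permutes_inverses[OF s_permutes] by auto

lemma sided_rotation_inv: "sided_rotation D r P (inv s)"
proof unfold_locales
  fix d show "P (inv s d) = P d" using P_s[of "inv s d"] by simp
qed (simp_all add: finite_arcs r_permutes permutes_inv[OF s_permutes])

text \<open>Inverting every rotation mirrors the surface: conjugating \<open>inv s \<circ> r\<close>
  by \<open>r\<close> gives \<open>inv (s \<circ> r)\<close>, whose orbits are those of
  \<open>s \<circ> r\<close>.\<close>

lemma face_of_inv: "face_of r (inv s) d = r ` face_of r s (r d)"
proof -
  have inv: "inv (s \<circ> r) = r \<circ> inv s"
    by (rule inv_unique_comp) (simp_all add: fun_eq_iff)
  have "face_of r s (r d) = orbit (r \<circ> inv s) (r d)"
    unfolding face_of_def by (subst orbit_inv_eq[OF face_permutation, symmetric]) (simp add: inv)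
  also have "r ` \<dots> = orbit (inv s \<circ> r) (r (r d))"
  proof (rule orbit_inverse)
    show "r d \<in> orbit (r \<circ> inv s) (r d)"
      using permutation_self_in_orbit[OF permutation_inverse[OF face_permutation]] by (simp add: inv)
  qed simp
  finally show ?thesis by (simp add: face_of_def comp_def)
qed

lemma face_of_inv_eq_iff:
  "face_of r (inv s) d = face_of r (inv s) e \<longleftrightarrow> face_of r s (r d) = face_of r s (r e)"
  unfolding face_of_inv using permutes_inj[OF r_permutes] by (simp add: inj_image_eq_iff)

lemma card_uncut_faces_inv: "card (uncut_faces D r P (inv s)) = card (uncut_faces D r P s)"
proof -
  have "uncut_faces D r P (inv s) = (`) r ` uncut_faces D r P s"
  proof -
    have meets: "r ` face_of r s (r d) \<inter> cut D r P = {} \<longleftrightarrow> face_of r s (r d) \<inter> cut D r P = {}" for d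
      by auto
    \<comment> \<open>On a face avoiding the cut, \<open>d\<close> and \<open>r d\<close> are on the
      same side, so the side condition may be read at either arc.\<close>
    have P: "P (r d) = P d" if "d \<in> D" "face_of r s (r d) \<inter> cut D r P = {}" for d
    proof -
      have "r d \<notin> cut D r P" using that(2) self_in_face[of "r d"] by blast
      with that(1) show ?thesis by (auto simp: cut_def)
    qed
    have "uncut_faces D r P (inv s) =
        (\<lambda>d. r ` face_of r s (r d)) ` {d \<in> D. \<not> P (r d) \<and> face_of r s (r d) \<inter> cut D r P = {}}"
      unfolding uncut_faces_def face_of_inv meets using P by (intro image_cong) auto
    also have "\<dots> = (\<lambda>d. r ` face_of r s d) ` r ` {d \<in> D. \<not> P (r d) \<and> face_of r s (r d) \<inter> cut D r P = {}}"
      by (simp add: image_image)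
    also have "r ` {d \<in> D. \<not> P (r d) \<and> face_of r s (r d) \<inter> cut D r P = {}} =
        {d \<in> D. \<not> P d \<and> face_of r s d \<inter> cut D r P = {}}"
      by (auto intro!: image_eqI[where x = "r d" for d])
    finally show ?thesis by (simp add: uncut_faces_def image_image)
  qed
  moreover have "inj_on ((`) r) A" for A
    using permutes_inj[OF r_permutes] by (simp add: inj_on_def inj_image_eq_iff)
  ultimately show ?thesis by (simp add: card_image)
qed

end

section \<open>Two rotations that agree on one side\<close>

locale agreeing_rotations =
  sided_rotation D r P s + new: sided_rotation D r P s' for D r P s s' +
  assumes agree: "\<And>d. d \<in> D \<Longrightarrow> \<not> P d \<Longrightarrow> s' d = s d"
begin

lemma agreeing_uncut_face:
  assumes "d \<in> D" "\<not> P d" "face_of r s d \<inter> cut D r P = {}"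
  shows "face_of r s' d = face_of r s d"
  unfolding face_of_def
proof (rule orbit_cong)
  show "d \<in> orbit (s \<circ> r) d" using self_in_face by (simp add: face_of_def)
  fix e assume "e \<in> orbit (s \<circ> r) d"
  then have e: "e \<in> face_of r s d" by (simp add: face_of_def)
  then have "e \<in> D" "\<not> P e" "e \<notin> cut D r P"
    using assms face_subset P_uncut_face by blast+
  then show "(s' \<circ> r) e = (s \<circ> r) e" by (auto simp: cut_def agree)
qed

text \<open>Agreement is symmetric, so the locale with \<open>s\<close> and \<open>s'\<close>
  exchanged gives the converse inclusion.\<close>

lemma uncut_faces_subset: "uncut_faces D r P s \<subseteq> uncut_faces D r P s'"
  unfolding uncut_faces_def using agreeing_uncut_face by force

text \<open>Until it leaves the side where the rotations agree, the face walk is the same for both.\<close>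

lemma first_exit:
  assumes d: "d \<in> D" "P d" "\<not> P (r d)"
  obtains y where "y \<in> D" "\<not> P y" "P (r y)"
    "face_of r s y = face_of r s d" "face_of r s' y = face_of r s' d"
proof -
  define f where "f = s \<circ> r"
  have f: "f e = s (r e)" for e by (simp add: f_def)
  define Q where "Q n \<longleftrightarrow> P (r ((f ^^ n) d))" for n
  \<comment> \<open>An exit exists: the walk is periodic, and the arc just before its return to
    \<open>d\<close> satisfies \<open>Q\<close> because \<open>P d\<close> holds.\<close>
  obtain m where m: "(f ^^ m) d = d" "0 < m"
    using permutation_self[OF face_permutation] unfolding f_def by blast
  then obtain m' where "m = Suc m'" by (cases m) auto
  with m d have "Q m'" unfolding Q_def by (metis P_s f funpow.simps(2) comp_apply)
  define n where "n = (LEAST n. Q n)"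
  have Qn: "Q n" unfolding n_def using \<open>Q m'\<close> by (rule LeastI)
  have least: "\<not> Q i" if "i < n" for i
    using that unfolding n_def by (rule not_less_Least)
  have *: "(f ^^ i) d \<in> D \<and> face_of r s ((f ^^ i) d) = face_of r s d
      \<and> face_of r s' ((f ^^ i) d) = face_of r s' d" if "i \<le> n" for i
    using that
  proof (induction i)
    case 0
    then show ?case using d by simp
  next
    case (Suc i)
    let ?e = "(f ^^ i) d"
    have e: "?e \<in> D" "\<not> P (r ?e)" using Suc least[of i] by (auto simp: Q_def)
    have "s (r ?e) = s' (r ?e)" using e by (simp add: agree)
    moreover have "(f ^^ Suc i) d = s (r ?e)" by (simp add: f_def)
    ultimately show ?case
      using Suc e face_of_step[of ?e] new.face_of_step[of ?e] by (metis Suc_leD r_in_iff s_in_iff)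
  qed
  \<comment> \<open>The walk does not exit at \<open>d\<close> itself, so the exit arc has a
    predecessor; there \<open>Q\<close> fails, which puts the tail of the exit arc on the side
    without \<open>P\<close>.\<close>
  have "n \<noteq> 0" using Qn d by (auto simp: Q_def intro: gr0I)
  then obtain n' where n': "n = Suc n'" by (cases n) auto
  have "\<not> P ((f ^^ n) d)"
    using least[of n'] by (simp add: n' Q_def f)
  with *[of n] Qn show thesis
    by (intro that[of "(f ^^ n) d"]) (auto simp: Q_def)
qed

end

section \<open>Reversing the rotation on one side\<close>

lemma range_step2_mod:
  fixes F :: "nat \<Rightarrow> 'x"
  assumes k: "0 < k" and step: "\<And>i. i < k \<Longrightarrow> F ((i + 2) mod k) = F i"
  shows "F ` {..<k} = {F 0, F (1 mod k)}" "odd k \<Longrightarrow> F (1 mod k) = F 0"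
proof -
  \<comment> \<open>The \<open>k\<close>-periodic extension to all naturals turns the cyclic shift
    by 2 into an ordinary one.\<close>
  define H where "H i = F (i mod k)" for i
  have H2: "H (i + 2) = H i" for i
    using step[of "i mod k"] k by (simp add: H_def mod_simps)
  have H2n: "H (i + 2 * n) = H i" for i n
    using H2[of "i + 2 * m" for m] by (induction n) (auto simp: algebra_simps)
  have H: "H i = H (i mod 2)" for i
    using H2n[of "i mod 2" "i div 2"] by simp
  have "F i \<in> {F 0, F (1 mod k)}" if "i < k" for i
  proof -
    have "F i = H i" using that by (simp add: H_def)
    also have "H i = H (i mod 2)" by (rule H)
    also have "H (i mod 2) \<in> {F 0, F (1 mod k)}"
      by (cases "even i") (simp_all add: H_def odd_iff_mod_2_eq_one)
    finally show ?thesis .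
  qed
  moreover have "0 \<in> {..<k}" "1 mod k \<in> {..<k}" using k by simp_all
  ultimately show "F ` {..<k} = {F 0, F (1 mod k)}" by blast
  \<comment> \<open>For odd \<open>k\<close> the index \<open>k\<close> is 0 modulo \<open>k\<close>
    but 1 modulo 2, which links the two values.\<close>
  show "F (1 mod k) = F 0" if "odd k"
    using H[of k] that by (simp add: H_def odd_iff_mod_2_eq_one)
qed

lemma Suc_mod_inj:
  assumes "Suc i mod k = Suc j mod k" "i < k" "j < k"
  shows "i = j"
  using assms by (auto simp: mod_Suc split: if_splits)

text \<open>
  The edges of the cut form a dual cycle: \<open>g i True\<close> and \<open>g i False\<close> are the two arcs of the
  \<open>i\<close>-th edge, lying on the base faces \<open>F i\<close> and \<open>F (i + 1)\<close>.
\<close>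

locale reversal_along_cycle =
  sided_rotation D r P s + new: sided_rotation D r P s' for D r P s s' +
  fixes k :: nat and g :: "nat \<Rightarrow> bool \<Rightarrow> 'a" and F :: "nat \<Rightarrow> 'a set"
  assumes agree: "\<And>d. d \<in> D \<Longrightarrow> \<not> P d \<Longrightarrow> s' d = s d"
    and reverse: "\<And>d. d \<in> D \<Longrightarrow> P d \<Longrightarrow> s' d = inv s d"
    and k_pos: "0 < k"
    and cut_eq: "cut D r P = (\<lambda>(i, b). g i b) ` ({..<k} \<times> UNIV)"
    and g_inj: "\<And>i j b c. i < k \<Longrightarrow> j < k \<Longrightarrow> g i b = g j c \<Longrightarrow> i = j \<and> b = c"
    and r_g: "\<And>i b. i < k \<Longrightarrow> r (g i b) = g i (\<not> b)"
    and face_g: "\<And>i b. i < k \<Longrightarrow> face_of r s (g i b) = F (if b then i else Suc i mod k)"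
    and F_inj: "inj_on F {..<k}"
begin

sublocale inverse: sided_rotation D r P "inv s"
  by (rule sided_rotation_inv)

sublocale side0: agreeing_rotations D r P s s'
  by unfold_locales (rule agree)

sublocale side0_rev: agreeing_rotations D r P s' s
  by unfold_locales (simp add: agree)

text \<open>On the reversed side the mirror embedding \<open>inv s\<close> takes the place of
  \<open>s\<close>.\<close>

lemma side1: "agreeing_rotations D r (\<lambda>d. \<not> P d) (inv s) s'"
  by (intro agreeing_rotations.intro agreeing_rotations_axioms.intro inverse.sided_rotation_Not
      new.sided_rotation_Not) (simp add: reverse)

lemma side1_rev: "agreeing_rotations D r (\<lambda>d. \<not> P d) s' (inv s)"
  by (intro agreeing_rotations.intro agreeing_rotations_axioms.intro inverse.sided_rotation_Not
      new.sided_rotation_Not) (simp add: reverse)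

text \<open>The walk on the reversed side follows a mirrored base face, so the base face is read at
  the reversed arcs \<open>r d\<close> and \<open>r y\<close>.\<close>

lemma first_exit1:
  assumes "d \<in> D" "\<not> P d" "P (r d)"
  obtains y where "y \<in> D" "P y" "\<not> P (r y)"
    "face_of r s (r y) = face_of r s (r d)" "face_of r s' y = face_of r s' d"
proof (rule agreeing_rotations.first_exit[OF side1 assms(1,2)])
  show "\<not> \<not> P (r d)" using assms(3) by simp
  fix y
  assume "y \<in> D" "\<not> \<not> P y" "\<not> P (r y)" "face_of r (inv s) y = face_of r (inv s) d"
    "face_of r s' y = face_of r s' d"
  then show thesis by (intro that[of y]) (simp_all add: face_of_inv_eq_iff)
qed

text \<open>Faces off the cut are unchanged on the side without \<open>P\<close> and mirrored on the
  side of \<open>P\<close>.\<close>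

lemma card_uncut_faces:
  "card (uncut_faces D r P s') = card (uncut_faces D r P s)"
  "card (uncut_faces D r (\<lambda>d. \<not> P d) s') = card (uncut_faces D r (\<lambda>d. \<not> P d) s)"
proof -
  show "card (uncut_faces D r P s') = card (uncut_faces D r P s)"
    using side0.uncut_faces_subset side0_rev.uncut_faces_subset by (simp add: subset_antisym)
  have "uncut_faces D r (\<lambda>d. \<not> P d) s' = uncut_faces D r (\<lambda>d. \<not> P d) (inv s)"
    using agreeing_rotations.uncut_faces_subset[OF side1]
      agreeing_rotations.uncut_faces_subset[OF side1_rev] by simp
  then show "card (uncut_faces D r (\<lambda>d. \<not> P d) s') = card (uncut_faces D r (\<lambda>d. \<not> P d) s)"
    by (simp add: sided_rotation.card_uncut_faces_inv[OF sided_rotation_Not])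
qed

section \<open>Cut arcs and base faces along the cycle\<close>

lemma g_in_cut: "i < k \<Longrightarrow> g i b \<in> cut D r P"
  unfolding cut_eq by (auto intro!: image_eqI[where x = "(i, b)"])

lemma g_in [simp]: "i < k \<Longrightarrow> g i b \<in> D"
  using g_in_cut[of i b] by (simp add: cut_def)

lemma P_g_Not: "i < k \<Longrightarrow> P (g i (\<not> b)) = (\<not> P (g i b))"
  using g_in_cut[of i b] by (auto simp: cut_def r_g)

lemma cutE:
  assumes "d \<in> cut D r P"
  obtains i b where "i < k" "d = g i b"
  using assms unfolding cut_eq by auto

lemma Suc_mod_less [simp]: "Suc i mod k < k"
  using k_pos by simp

text \<open>By injectivity of \<open>F\<close>, a base face on the cycle carries just two cut arcs,
  one from each neighbouring edge; for \<open>k = 1\<close> these are the two arcs of the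
  loop.\<close>

lemma same_face_cases:
  assumes "d \<in> cut D r P" "e \<in> cut D r P" "d \<noteq> e" "face_of r s d = face_of r s e"
  obtains i where "i < k" "{d, e} = {g i False, g (Suc i mod k) True}"
proof -
  obtain i b j c where d: "i < k" "d = g i b" and e: "j < k" "e = g j c"
    using assms(1,2) by (metis cutE)
  have "(if b then i else Suc i mod k) = (if c then j else Suc j mod k)"
    using assms(4) d e by (intro inj_onD[OF F_inj]) (auto simp: face_g)
  with assms(3) d e Suc_mod_inj[of i k j] that[of i] that[of j] show thesis
    by (cases b; cases c) auto
qed

lemma same_face_unique:
  assumes "d \<in> cut D r P" "e \<in> cut D r P" "d \<noteq> e" "face_of r s d = face_of r s e"
    and "e' \<in> cut D r P" "d \<noteq> e'" "face_of r s d = face_of r s e'"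
  shows "e' = e"
proof -
  obtain i where i: "i < k" "{d, e} = {g i False, g (Suc i mod k) True}"
    using assms(1-4) by (rule same_face_cases)
  obtain j where j: "j < k" "{d, e'} = {g j False, g (Suc j mod k) True}"
    using assms(1,5-7) by (rule same_face_cases)
  have "i = j"
    using i j g_inj[of i j False False] g_inj[of i "Suc j mod k" False True]
      g_inj[of "Suc i mod k" j True False] g_inj[of "Suc i mod k" "Suc j mod k" True True]
      Suc_mod_inj[of i k j]
    by (auto simp: doubleton_eq_iff)
  with i j assms(3,6) show ?thesis by (auto simp: doubleton_eq_iff)
qed

text \<open>Past \<open>d\<close> the new walk follows the base face on the side without
  \<open>P\<close> up to its next cut arc, and the only candidate is the partner \<open>e\<close> of
  \<open>d\<close>.\<close>

lemma segment0:
  assumes "d \<in> cut D r P" "e \<in> cut D r P" "d \<noteq> e" "face_of r s d = face_of r s e" "P d"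
  shows "face_of r s' d = face_of r s' e" "\<not> P e"
proof -
  have "d \<in> D" "\<not> P (r d)" using assms(1,5) by (auto simp: cut_def)
  then obtain y where y: "y \<in> D" "\<not> P y" "P (r y)"
    "face_of r s y = face_of r s d" "face_of r s' y = face_of r s' d"
    using side0.first_exit assms(5) by blast
  have "y = e"
    using assms y by (intro same_face_unique[of d e y]) (auto simp: cut_def)
  with y show "face_of r s' d = face_of r s' e" "\<not> P e" by auto
qed

lemma segment1:
  assumes "d \<in> cut D r P" "e \<in> cut D r P" "d \<noteq> e" "face_of r s (r d) = face_of r s (r e)" "\<not> P d"
  shows "face_of r s' d = face_of r s' e"
proof -
  have "d \<in> D" "P (r d)" using assms(1,5) by (auto simp: cut_def)
  then obtain y where y: "y \<in> D" "P y" "\<not> P (r y)"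
    "face_of r s (r y) = face_of r s (r d)" "face_of r s' y = face_of r s' d"
    using assms(5) first_exit1 by blast
  \<comment> \<open>The shared base face belongs to the reversed arcs, so uniqueness of the partner
    is applied to them.\<close>
  have "r y = r e"
    using assms y
    by (intro same_face_unique[of "r d" "r e" "r y"]) (auto simp: cut_def)
  then have "y = e" by simp
  with y show "face_of r s' d = face_of r s' e" by auto
qed

lemma neighbours:
  assumes "i < k"
  shows "g i False \<noteq> g (Suc i mod k) True"
    "face_of r s (g i False) = face_of r s (g (Suc i mod k) True)"
  using assms g_inj[of i "Suc i mod k" False True] by (auto simp: face_g)

text \<open>A base face walk crosses its two cut arcs in opposite directions, since it must return
  to the side it left. Hence all edges of the cycle, oriented along it, cross the cut in the same
  direction.\<close>

lemma P_g_Suc: "i < k \<Longrightarrow> P (g (Suc i mod k) True) = P (g i True)"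
proof -
  assume i: "i < k"
  have "P (g i False) \<Longrightarrow> \<not> P (g (Suc i mod k) True)"
    using i neighbours by (intro segment0(2)[of "g i False"]) (auto simp: g_in_cut)
  moreover have "\<not> P (g i False) \<Longrightarrow> P (g (Suc i mod k) True)"
  proof -
    assume *: "\<not> P (g i False)"
    \<comment> \<open>With both rotations equal to \<open>s\<close>, \<open>first_exit\<close>
      speaks about base faces alone.\<close>
    interpret N: agreeing_rotations D r "\<lambda>d. \<not> P d" s s
      by (intro agreeing_rotations.intro agreeing_rotations_axioms.intro sided_rotation_Not) simp
    obtain y where "y \<in> D" "P y" "\<not> P (r y)" "face_of r s y = face_of r s (g i False)"
      using N.first_exit[of "g i False"] i * P_g_Not[of i False] by (auto simp: r_g)
    moreover from this have "y = g (Suc i mod k) True"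
      using i * neighbours[OF i] g_in_cut
      by (intro same_face_unique[of "g i False"]) (auto simp: cut_def[of D r P])
    ultimately show ?thesis by simp
  qed
  ultimately show ?thesis using P_g_Not[OF i, of True] by auto
qed

text \<open>The labelling may run either way round; the arcs \<open>g i out_dir\<close> are those
  leading out of the side of \<open>P\<close>.\<close>

definition out_dir :: bool where
  "out_dir = P (g 0 True)"

lemma P_g: "i < k \<Longrightarrow> P (g i b) \<longleftrightarrow> b = out_dir"
proof -
  have True_case: "P (g i True) = out_dir" if "i < k" for i
    using that
  proof (induction i)
    case (Suc i)
    then show ?case using P_g_Suc[of i] by simp
  qed (simp add: out_dir_def)
  assume "i < k"
  with True_case[of i] P_g_Not[of i True] show ?thesis by (cases b) auto
qed

section \<open>The new faces that meet the cut\<close>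

definition new_face :: "nat \<Rightarrow> 'a set" where
  "new_face i = face_of r s' (g i out_dir)"

text \<open>One segment on each side is traversed. In the base embedding the second side would offer
  the same base face again; mirrored, it offers the next one, so the walk advances by two
  edges.\<close>

lemma new_face_step:
  assumes i: "i < k"
  shows "new_face ((i + 2) mod k) = new_face i"
proof -
  define i1 where "i1 = Suc i mod k"
  define i2 where "i2 = Suc i1 mod k"
  have lt: "i1 < k" "i2 < k" by (simp_all add: i1_def i2_def)
  have i2: "(i + 2) mod k = i2" by (simp add: i1_def i2_def mod_simps)
  note n1 = neighbours[OF i, folded i1_def] and n2 = neighbours[OF lt(1), folded i2_def]
  show ?thesis
  proof (cases out_dir)
    \<comment> \<open>Here the walk runs towards smaller indices, so it is followed from
      \<open>i2\<close> back to \<open>i\<close>.\<close>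
    case True
    have "face_of r s' (g i2 True) = face_of r s' (g i1 False)"
      using n2 lt True by (intro segment0(1)) (auto simp: g_in_cut P_g)
    also have "\<dots> = face_of r s' (g i True)"
      using n1 lt i True by (intro segment1) (auto simp: g_in_cut P_g r_g dest: g_inj[rotated 2])
    finally show ?thesis unfolding i2 new_face_def using True by simp
  next
    case False
    have "face_of r s' (g i False) = face_of r s' (g i1 True)"
      using n1 i lt False by (intro segment0(1)) (auto simp: g_in_cut P_g)
    also have "\<dots> = face_of r s' (g i2 False)"
      using n2 lt i False by (intro segment1) (auto simp: g_in_cut P_g r_g dest: g_inj[rotated 2])
    finally show ?thesis unfolding i2 new_face_def using False by simp
  qed
qed

text \<open>A walk that enters the side of \<open>P\<close> leaves it again, so every new face
  meeting the cut contains some arc \<open>g j out_dir\<close>.\<close>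

lemma cut_faces_new: "face_of r s' ` cut D r P = new_face ` {..<k}"
proof (intro equalityI subsetI)
  fix f assume "f \<in> face_of r s' ` cut D r P"
  then obtain i b where i: "i < k" "f = face_of r s' (g i b)" by (auto elim: cutE)
  show "f \<in> new_face ` {..<k}"
  proof (cases "b = out_dir")
    case True
    then show ?thesis using i by (auto simp: new_face_def)
  next
    case False
    have "\<not> P (g i b)" "P (r (g i b))" using i False by (auto simp: P_g r_g)
    then obtain y where y: "y \<in> D" "P y" "\<not> P (r y)" "face_of r s' y = f"
      unfolding i(2) using first_exit1[OF g_in[OF i(1)]] by blast
    then have "y \<in> cut D r P" by (simp add: cut_def)
    then obtain j c where "j < k" "y = g j c" by (rule cutE)
    with y show ?thesis by (auto simp: new_face_def P_g)
  qed
qed (auto simp: new_face_def g_in_cut)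

text \<open>
  Colour every segment by the parity of its base face, with the colours exchanged on the reversed
  side.  If \<open>k\<close> is even, the new face walks preserve the colour.
\<close>

definition even_segments :: "'a set" where
  "even_segments = {d \<in> D. if P (r d) then \<exists>i<k. odd i \<and> face_of r s (r d) = F i
     else \<exists>i<k. even i \<and> face_of r s d = F i}"

lemma F_index: "l < k \<Longrightarrow> (\<exists>i<k. Q i \<and> F l = F i) \<longleftrightarrow> Q l"
  by (metis F_inj inj_onD lessThan_iff)

text \<open>The base faces on the two sides of a cut edge have consecutive indices; for even
  \<open>k\<close> their parities differ even at the wraparound. So both clauses of
  \<open>even_segments\<close> agree on cut arcs.\<close>

lemma face_parity_flip:
  assumes "even k" "d \<in> cut D r P"
  shows "(\<exists>i<k. odd i \<and> face_of r s (r d) = F i) \<longleftrightarrow> (\<exists>i<k. even i \<and> face_of r s d = F i)"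
proof -
  obtain j b where j: "j < k" "d = g j b" using assms(2) by (rule cutE)
  have par: "even (Suc j mod k) \<longleftrightarrow> odd j"
    using assms(1) j by (auto simp: mod_Suc)
  show ?thesis
    using j par by (cases b) (simp_all add: r_g face_g F_index)
qed

text \<open>Within a segment the underlying base face is constant; at a crossing the other clause of
  the definition takes over, and \<open>face_parity_flip\<close> matches the two.\<close>

lemma even_segments_step:
  assumes "even k" and d: "d \<in> even_segments"
  shows "s' (r d) \<in> even_segments"
proof (cases "P (r d)")
  case False
  let ?e = "s' (r d)"
  have "d \<in> D" using d by (simp add: even_segments_def)
  then have e: "?e = s (r d)" "?e \<in> D" "\<not> P ?e"
    using False by (simp_all add: agree)
  have ev: "\<exists>i<k. even i \<and> face_of r s ?e = F i"
    using d False e by (simp add: even_segments_def face_of_step)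
  show ?thesis
  proof (cases "P (r ?e)")
    case True
    then have "?e \<in> cut D r P" using e by (simp add: cut_def)
    from face_parity_flip[OF assms(1) this] ev True e(2) show ?thesis
      by (simp add: even_segments_def)
  qed (use e(2) ev in \<open>simp add: even_segments_def\<close>)
next
  case True
  let ?e = "s' (r d)"
  have "d \<in> D" using d by (simp add: even_segments_def)
  \<comment> \<open>On the reversed side the base walk runs backwards, from \<open>r ?e\<close> to
    \<open>r d\<close>.\<close>
  then have e: "s ?e = r d" "?e \<in> D" "P ?e"
    using True by (simp_all add: reverse)
  have ev: "\<exists>i<k. odd i \<and> face_of r s (r ?e) = F i"
    using d True e(1) face_of_step[of "r ?e"] by (simp add: even_segments_def)
  show ?thesis
  proof (cases "P (r ?e)")
    case False
    then have "?e \<in> cut D r P" using e by (simp add: cut_def)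
    from face_parity_flip[OF assms(1) this] ev False e(2) show ?thesis
      by (simp add: even_segments_def)
  qed (use e(2) ev in \<open>simp add: even_segments_def\<close>)
qed

lemma new_face_0_neq_1:
  assumes "even k"
  shows "new_face 0 \<noteq> new_face 1"
proof
  assume eq: "new_face 0 = new_face 1"
  have k: "1 < k" using assms k_pos by (cases "k = 1") auto
  have seg: "g i out_dir \<in> even_segments \<longleftrightarrow> even (if out_dir then i else Suc i mod k)" if "i < k" for i
    using that by (simp add: even_segments_def P_g r_g face_g F_index)
  have par: "even (Suc i mod k) \<longleftrightarrow> odd i" if "i < k" for i
    using assms that by (auto simp: mod_Suc)
  \<comment> \<open>\<open>z\<close> is the index among 0 and 1 whose outgoing arc has the even
    colour; for \<open>out_dir\<close> false that arc lies on the base face with the next index,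
    hence the swap.\<close>
  define z where "z = (if out_dir then 0 else 1 :: nat)"
  have "e \<in> even_segments" if "e \<in> new_face z" for e
    using that unfolding new_face_def face_of_def
  proof induction
    case base
    have "g z out_dir \<in> even_segments"
      using k par by (simp add: seg z_def)
    then show ?case using even_segments_step[OF assms] by simp
  qed (use even_segments_step[OF assms] in simp)
  moreover have "g (1 - z) out_dir \<in> new_face z"
    using eq new.self_in_face[of "g (1 - z) out_dir"] unfolding new_face_def z_def by auto
  moreover have "g (1 - z) out_dir \<notin> even_segments"
    using k par by (simp add: seg z_def)
  ultimately show False by blast
qed

lemma card_cut_faces_new: "card (face_of r s' ` cut D r P) = (if even k then 2 else 1)"
proof -
  have img: "new_face ` {..<k} = {new_face 0, new_face (1 mod k)}"
    "odd k \<Longrightarrow> new_face (1 mod k) = new_face 0"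
    using range_step2_mod[of k new_face] k_pos new_face_step by blast+
  show ?thesis
  proof (cases "even k")
    case True
    then have "1 mod k = 1" using k_pos by (cases "k = 1") auto
    with img(1) have "new_face ` {..<k} = {new_face 0, new_face 1}" by simp
    with True new_face_0_neq_1 show ?thesis by (simp add: cut_faces_new)
  next
    case False
    have "new_face ` {..<k} = {new_face 0}"
      unfolding img(1) img(2)[OF False] by simp
    with False show ?thesis by (simp add: cut_faces_new)
  qed
qed

lemma card_cut_faces: "card (face_of r s ` cut D r P) = k"
proof -
  have "face_of r s ` cut D r P = F ` {..<k}"
  proof (intro equalityI subsetI)
    fix f assume "f \<in> face_of r s ` cut D r P"
    then obtain i b where "i < k" "f = face_of r s (g i b)" by (auto elim: cutE)
    then show "f \<in> F ` {..<k}" by (simp add: face_g)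
  next
    fix f assume "f \<in> F ` {..<k}"
    then obtain i where i: "i < k" "f = F i" by auto
    then have "f = face_of r s (g i True)" by (simp add: face_g)
    with g_in_cut[OF i(1)] show "f \<in> face_of r s ` cut D r P" by blast
  qed
  then show ?thesis by (simp add: card_image[OF F_inj])
qed

text \<open>Only the faces meeting the cut change in number, from \<open>k\<close> to
  \<open>gcd 2 k\<close>.\<close>

lemma card_faces_reversal:
  "card (face_of r s' ` D) + k = card (face_of r s ` D) + (if even k then 2 else 1)"
  using card_faces_split new.card_faces_split card_uncut_faces card_cut_faces card_cut_faces_new
  by linarith

end

section \<open>The genus\<close>

lemma (in rotation_system) tail_rotation: "tail G (s d) = tail G d"
proof (cases "d \<in> arcs G")
  case True
  then have "cyclic_on s (out_arcs G (tail G d))"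
    by (intro rotation_cyclic) auto
  then have "s d \<in> out_arcs G (tail G d)"
    by (rule cyclic_on_inI) (simp add: True)
  then show ?thesis by simp
next
  case False
  then show ?thesis using permutes_not_in[OF rotation_permutes] by metis
qed

text \<open>At a vertex of degree three, instability at one arc leaves only the inverse rotation for
  all three.\<close>

lemma cubic_unstable_rotation:
  assumes base: "rotation_system G r s0" and emb: "rotation_system G r s"
    and cubic: "\<forall>v \<in> verts G. out_degree G v = 3"
    and v: "v \<in> unstable_verts G s0 s" and d: "d \<in> out_arcs G v"
  shows "s d = inv s0 d"
proof -
  interpret B: rotation_system G r s0 by (rule base)
  interpret E: rotation_system G r s by (rule emb)
  obtain a where a: "v \<in> verts G" "a \<in> out_arcs G v" "s a \<noteq> s0 a"
    using v by (auto simp: unstable_verts_def)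
  have ne: "out_arcs G v \<noteq> {}" using d by auto
  have "tail G (inv s0 d) = tail G (s0 (inv s0 d))" by (simp only: B.tail_rotation)
  also have inv: "s0 (inv s0 d) = d"
    using permutes_inverses(1)[OF B.rotation_permutes] by simp
  finally have "inv s0 d \<in> out_arcs G v"
    using d permutes_in_image[OF permutes_inv[OF B.rotation_permutes]] by auto
  then have "s (s0 (inv s0 d)) = inv s0 d"
    using cubic a ne
    by (intro cyclic_on_card_3_inverse[where A = "out_arcs G v" and a = a])
      (auto simp: out_degree_def intro: B.rotation_cyclic E.rotation_cyclic
        permutes_inj[OF B.rotation_permutes] permutes_inj[OF E.rotation_permutes])
  with inv show ?thesis by simp
qed

lemma tail_unstable_dual: "tail (unstable_dual G r s0 s) = face_of r s0"
  and arcs_unstable_dual: "arcs (unstable_dual G r s0 s) = unstable_arcs G s0 s"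
  by (simp_all add: unstable_dual_def dual_def)

text \<open>Inverting the isomorphism labels unstable arcs by arcs \<open>(i, b)\<close> of the
  cycle graph and unstable faces by its vertices, which supplies \<open>g\<close> and
  \<open>F\<close>.\<close>

lemma reversal_along_unstable_cycle:
  fixes G :: "('a, 'b) pre_digraph"
  assumes base: "rotation_system G r s0" and emb: "rotation_system G r s"
    and cubic: "\<forall>v \<in> verts G. out_degree G v = 3"
    and k: "k \<ge> 1"
    and cyc: "multigraph_iso (unstable_dual G r s0 s) r (cycle_graph k) cycle_graph_rev"
  obtains g F where
    "reversal_along_cycle (arcs G) r (\<lambda>d. tail G d \<in> unstable_verts G s0 s) s0 s k g F"
proof -
  interpret B: rotation_system G r s0 by (rule base)
  interpret E: rotation_system G r s by (rule emb)
  let ?U = "unstable_verts G s0 s" and ?H = "unstable_dual G r s0 s"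
  let ?P = "\<lambda>d. tail G d \<in> ?U"
  obtain f where iso: "pre_digraph.digraph_isomorphism ?H f"
    and app: "cycle_graph k = app_iso f ?H"
    and rev: "\<forall>d \<in> arcs ?H. iso_arcs f (r d) = cycle_graph_rev (iso_arcs f d)"
    using cyc by (auto simp: multigraph_iso_def)
  interpret H: pre_digraph ?H .
  have wf: "wf_digraph ?H" and injV: "inj_on (iso_verts f) (verts ?H)"
    and injA: "inj_on (iso_arcs f) (arcs ?H)"
    and tl: "\<And>a. a \<in> arcs ?H \<Longrightarrow> iso_verts f (tail ?H a) = iso_tail f (iso_arcs f a)"
    using iso by (auto simp: H.digraph_isomorphism_def)
  have V: "iso_verts f ` verts ?H = {..<k}" and A: "iso_arcs f ` arcs ?H = {..<k} \<times> UNIV"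
    and T: "iso_tail f = (\<lambda>(i, fwd). if fwd then i else Suc i mod k)"
    using arg_cong[OF app, of verts] arg_cong[OF app, of arcs] arg_cong[OF app, of tail]
    by (simp_all add: cycle_graph_def)
  have cut: "cut (arcs G) r ?P = arcs ?H"
    by (auto simp: cut_def arcs_unstable_dual unstable_arcs_def)
  define g where "g i b = inv_into (arcs ?H) (iso_arcs f) (i, b)" for i b
  define F where "F = inv_into (verts ?H) (iso_verts f)"
  have g: "g i b \<in> arcs ?H" "iso_arcs f (g i b) = (i, b)" if "i < k" for i b
    using that A unfolding g_def by (auto intro: inv_into_into f_inv_into_f)
  have g_iso: "a = g i b" if "a \<in> arcs ?H" "iso_arcs f a = (i, b)" for a i b
    using that injA unfolding g_def by (metis inv_into_f_f)
  have "reversal_along_cycle (arcs G) r ?P s0 s k g F"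
  proof unfold_locales
    show "finite (arcs G)" by simp
    show "r permutes arcs G" by (rule B.arev_permutes_arcs)
    show "r (r d) = d" for d by simp
    show "s0 permutes arcs G" "s permutes arcs G"
      by (rule B.rotation_permutes E.rotation_permutes)+
    show "?P (s0 d) = ?P d" "?P (s d) = ?P d" for d
      by (simp_all add: B.tail_rotation E.tail_rotation)
    show "s d = s0 d" if "d \<in> arcs G" "\<not> ?P d" for d
      using that by (auto simp: unstable_verts_def)
    show "s d = inv s0 d" if "d \<in> arcs G" "?P d" for d
      using that by (intro cubic_unstable_rotation[OF base emb cubic]) auto
    show "0 < k" using k by simp
    show "cut (arcs G) r ?P = (\<lambda>(i, b). g i b) ` ({..<k} \<times> UNIV)"
    proof (intro equalityI subsetI)
      fix a assume "a \<in> cut (arcs G) r ?P"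
      then have a: "a \<in> arcs ?H" by (simp add: cut)
      then have "iso_arcs f a \<in> {..<k} \<times> UNIV" using A by blast
      with g_iso[OF a] show "a \<in> (\<lambda>(i, b). g i b) ` ({..<k} \<times> UNIV)"
        by (intro image_eqI[where x = "iso_arcs f a"]) (auto split: prod.split)
    qed (auto simp: cut g)
    show "i = j \<and> b = c" if "i < k" "j < k" "g i b = g j c" for i j b c
      using that g(2) by (metis prod.inject)
    show "r (g i b) = g i (\<not> b)" if "i < k" for i b
    proof (rule g_iso)
      have "g i b \<in> cut (arcs G) r ?P" using g(1)[OF that] by (simp add: cut)
      then have "r (g i b) \<in> cut (arcs G) r ?P" by (auto simp: cut_def)
      then show "r (g i b) \<in> arcs ?H" by (simp add: cut)
      show "iso_arcs f (r (g i b)) = (i, \<not> b)"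
        using rev g[OF that] by (simp add: cycle_graph_rev_def)
    qed
    \<comment> \<open>Tails in the dual are faces, so the isomorphism sends this face to the tail of
      \<open>(i, b)\<close>.\<close>
    show "face_of r s0 (g i b) = F (if b then i else Suc i mod k)" if "i < k" for i b
    proof -
      have "face_of r s0 (g i b) \<in> verts ?H"
        using wf_digraph.tail_in_verts[OF wf g(1)[OF that]] by (simp add: tail_unstable_dual)
      moreover have "iso_verts f (face_of r s0 (g i b)) = (if b then i else Suc i mod k)"
        using tl[OF g(1)[OF that]] g(2)[OF that] by (simp add: tail_unstable_dual T)
      ultimately show ?thesis unfolding F_def by (rule inv_into_f_eq[OF injV, symmetric])
    qed
    show "inj_on F {..<k}"
      unfolding F_def V[symmetric] by (rule inj_on_inv_into) simp
  qed
  then show thesis by (rule that)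
qed

theorem theorem4p9:
  fixes G :: "('a, 'b) pre_digraph"
    and r s0 s :: "'b \<Rightarrow> 'b"
    and k :: nat
  assumes base: "rotation_system G r s0"
    and emb: "rotation_system G r s"
    and conn: "connected G"
    and cubic: "\<forall>v \<in> verts G. out_degree G v = 3"
    and k: "k \<ge> 1"
    and cyc: "multigraph_iso (unstable_dual G r s0 s) r (cycle_graph k) cycle_graph_rev"
    and zero: "zero_homologous (dual G r s0) r (dual_rotation r s0) (unstable_dual G r s0 s)"
  shows "genus G r s - genus G r s0 = \<lfloor>(real k - 1) / 2\<rfloor>"
proof -
  obtain g F where
    "reversal_along_cycle (arcs G) r (\<lambda>d. tail G d \<in> unstable_verts G s0 s) s0 s k g F"
    using reversal_along_unstable_cycle[OF base emb cubic k cyc] .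
  from reversal_along_cycle.card_faces_reversal[OF this]
  have card: "card (faces G r s) + k = card (faces G r s0) + (if even k then 2 else 1)"
    by (simp add: faces_def)
  \<comment> \<open>\<open>2 * m\<close> is the number of faces lost,
    \<open>k - gcd 2 k\<close>.\<close>
  define m where "m = (k - 1) div 2"
  have "k = 2 * m + (if even k then 2 else 1)"
    using k unfolding m_def by (auto elim!: evenE oddE split: if_splits)
  with card have "euler_char G r s0 = euler_char G r s + 2 * int m"
    unfolding euler_char_def by linarith
  \<comment> \<open>A change of the Euler characteristic by an even number shifts the quotient by
    exactly half of it, whatever the remainder.\<close>
  then have "genus G r s - genus G r s0 = int m"
    unfolding genus_def by presburger
  also have "int m = \<lfloor>(real k - 1) / 2\<rfloor>"
    using floor_divide_of_nat_eq[of "k - 1" 2, where ?'a = real] k by (simp add: m_def of_nat_diff)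
  finally show ?thesis .
qed

end
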